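(* Let $n\ge 1$ and, for each $i\in[n]$, let $\mathcal{M}_i=(S_i,A_i,P_i,s_0^i)$ be a finite Markov decision process, $\pi^{\mathcal{S}}_i\in\Pi(\mathcal{M}_i)$ a stationary reference policy, and $R^{\mathcal{A}}_i\subseteq S_i$ a set of absorbing states; let $\nu_{\mathcal{A}}\ge 0$. Consider the optimization problem over vectors $\mathbf{x}_i=(x_{s,a})_{s\in S_{d,i},\,a\in A_i(s)}$ of real numbers $$\inf_{(\mathbf{x}_1,\ldots,\mathbf{x}_n)}\ \max_{i\in[n]}\ \mathrm{KL}(\mathbf{x}_i,\pi^{\mathcal{S}}_i)\quad\text{subject to}\quad \begin{cases}F(\mathbf{x}_i,s)=0 & \forall s\in S_{d,i},\ \forall i\in[n],\\ \prod_{i=1}^n\big(1-\nu(\mathbf{x}_i,R^{\mathcal{A}}_i)\big)\le 1-\nu_{\mathcal{A}},\\ \mathbf{x}_i\ge 0 & \forall i\in[n].\end{cases}$$ Then every local minimum of this problem is a global minimum.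
   Context: $[n]=\{1,\ldots,n\}$. A Markov decision process (MDP) $\mathcal{M}=(S,A,P,s_0)$ has state space $S$, action space $A$, transition probabilities $P(s,a,q)$ (probability of moving from $s$ to $q$ under action $a$), and initial state $s_0$; $A(s)$ is the (nonempty) set of actions available at $s$. $\mathrm{Succ}(s)$ is the set of $q$ such that $P(s,a,q)>0$ for some $a\in A(s)$; $s$ is absorbing if $\mathrm{Succ}(s)=\{s\}$. All state and action spaces are finite. A stationary policy is a map $\pi:S\times A\to[0,1]$ with $\sum_{a\in A(s)}\pi(s,a)=1$ for every $s$; $\Pi(\mathcal{M})$ is the set of stationary policies. For each $i$, let $C^{cl}_i$ be the union of the closed communicating classes of the Markov chain induced on $S_i$ by $\pi^{\mathcal{S}}_i$, and let $S_{d,i}=S_i\setminus(C^{cl}_i\cup R^{\mathcal{A}}_i)$. Write $\pi^{\mathcal{S}}_{s,q}=\sum_{a\in A_i(s)}P_i(s,a,q)\pi^{\mathcal{S}}_i(s,a)$, and, for a vector $\mathbf{x}_i=(x_{s,a})_{s\in S_{d,i},a\in A_i(s)}$, $x_{s,q}=\sum_{a\in A_i(s)}x_{s,a}P_i(s,a,q)$. With $\mathbb{1}_{s_0^i}(s)=1$ if $s=s_0^i$ and $0$ otherwise, define $$\mathrm{KL}(\mathbf{x}_i,\pi^{\mathcal{S}}_i)=\sum_{s\in S_{d,i}}\sum_{q\in\mathrm{Succ}_i(s)}x_{s,q}\log\!\left(\frac{x_{s,q}}{\pi^{\mathcal{S}}_{s,q}\sum_{a'\in A_i(s)}x_{s,a'}}\right),$$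 $$F(\mathbf{x}_i,s)=\sum_{a\in A_i(s)}x_{s,a}-\sum_{q\in S_{d,i}}x_{q,s}-\mathbb{1}_{s_0^i}(s),$$ $$\nu(\mathbf{x}_i,R_i)=\sum_{q\in R_i}\Big(\mathbb{1}_{s_0^i}(q)+\sum_{s\in S_{d,i}}x_{s,q}\Big),$$ with the conventions that a term with $x_{s,q}=0$ equals $0$ and a term with $x_{s,q}>0$ and $\pi^{\mathcal{S}}_{s,q}=0$ equals $+\infty$. A local minimum of the problem is a feasible point with finite objective value whose objective value is at most that of every feasible point in some Euclidean neighbourhood of it; a global minimum is a feasible point whose objective value is at most that of every feasible point.
   Formalization: The formal theorem additionally assumes that n = 1 or ν_A ≠ 1; for n ≥ 2 and ν_A = 1 the claim is false, since the product constraint then forces some agent to have ν(x_i) = 1 and a minimum over one such face can be local but not global. *)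

theory Defs
  imports "HOL-Analysis.Analysis"
begin

record ('s, 'a) mdp =
  states :: "'s set"
  actions :: "'a set"
  avail :: "'s \<Rightarrow> 'a set"
  prob :: "'s \<Rightarrow> 'a \<Rightarrow> 's \<Rightarrow> real"
  init :: 's

definition finite_mdp :: "('s, 'a) mdp \<Rightarrow> bool" where
  "finite_mdp M \<longleftrightarrow>
     finite (states M) \<and> finite (actions M) \<and> init M \<in> states M \<and>
     (\<forall>s\<in>states M. avail M s \<noteq> {} \<and> avail M s \<subseteq> actions M \<and>
        (\<forall>a\<in>avail M s. (\<forall>q\<in>states M. 0 \<le> prob M s a q) \<and>
                        (\<Sum>q\<in>states M. prob M s a q) = 1))"

definition Succ :: "('s, 'a) mdp \<Rightarrow> 's \<Rightarrow> 's set" where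
  "Succ M s = {q \<in> states M. \<exists>a\<in>avail M s. prob M s a q > 0}"

definition absorbing :: "('s, 'a) mdp \<Rightarrow> 's \<Rightarrow> bool" where
  "absorbing M s \<longleftrightarrow> s \<in> states M \<and> Succ M s = {s}"

definition stationary_policy :: "('s, 'a) mdp \<Rightarrow> ('s \<Rightarrow> 'a \<Rightarrow> real) \<Rightarrow> bool" where
  "stationary_policy M \<pi> \<longleftrightarrow>
     (\<forall>s\<in>states M. \<forall>a\<in>actions M. 0 \<le> \<pi> s a \<and> \<pi> s a \<le> 1) \<and>
     (\<forall>s\<in>states M. (\<Sum>a\<in>avail M s. \<pi> s a) = 1)"

text \<open>
  With \<open>w\<close> a policy, \<open>flow M w s q\<close> is the transition probability \<open>\<pi>\<^sub>s\<^sub>,\<^sub>q\<close> of the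
  induced chain; with \<open>w\<close> a vector of occupation variables it is \<open>x\<^sub>s\<^sub>,\<^sub>q\<close>.
\<close>

definition flow :: "('s, 'a) mdp \<Rightarrow> ('s \<Rightarrow> 'a \<Rightarrow> real) \<Rightarrow> 's \<Rightarrow> 's \<Rightarrow> real" where
  "flow M w s q = (\<Sum>a\<in>avail M s. w s a * prob M s a q)"

definition chain_edges :: "('s, 'a) mdp \<Rightarrow> ('s \<Rightarrow> 'a \<Rightarrow> real) \<Rightarrow> 's rel" where
  "chain_edges M \<pi> = {(s, q). s \<in> states M \<and> q \<in> states M \<and> flow M \<pi> s q > 0}"

definition communicates :: "('s, 'a) mdp \<Rightarrow> ('s \<Rightarrow> 'a \<Rightarrow> real) \<Rightarrow> 's rel" where
  "communicates M \<pi> = {(s, q). s \<in> states M \<and> q \<in> states M \<and>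
     (s, q) \<in> (chain_edges M \<pi>)\<^sup>* \<and> (q, s) \<in> (chain_edges M \<pi>)\<^sup>*}"

definition closed_classes :: "('s, 'a) mdp \<Rightarrow> ('s \<Rightarrow> 'a \<Rightarrow> real) \<Rightarrow> 's set set" where
  "closed_classes M \<pi> =
     {C \<in> states M // communicates M \<pi>. chain_edges M \<pi> `` C \<subseteq> C}"

definition decision_states ::
  "('s, 'a) mdp \<Rightarrow> ('s \<Rightarrow> 'a \<Rightarrow> real) \<Rightarrow> 's set \<Rightarrow> 's set" where
  "decision_states M \<pi> R = states M - (\<Union> (closed_classes M \<pi>) \<union> R)"

definition init_ind :: "('s, 'a) mdp \<Rightarrow> 's \<Rightarrow> real" where
  "init_ind M s = (if s = init M then 1 else 0)"

text \<open>
  A summand of the divergence, for \<open>y = x\<^sub>s\<^sub>,\<^sub>q\<close>, \<open>p = \<pi>\<^sub>s\<^sub>,\<^sub>q\<close> and \<open>z\<close> the total mass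
  \<open>x\<^sub>s\<^sub>,\<^sub>a\<close> summed over the actions available at \<open>s\<close>.
\<close>

definition kl_term :: "real \<Rightarrow> real \<Rightarrow> real \<Rightarrow> ereal" where
  "kl_term y p z =
     (if y = 0 then 0
      else if y > 0 \<and> p = 0 then \<infinity>
      else ereal (y * ln (y / (p * z))))"

definition KL ::
  "('s, 'a) mdp \<Rightarrow> ('s \<Rightarrow> 'a \<Rightarrow> real) \<Rightarrow> 's set \<Rightarrow> ('s \<Rightarrow> 'a \<Rightarrow> real) \<Rightarrow> ereal" where
  "KL M \<pi> R x =
     (\<Sum>s\<in>decision_states M \<pi> R. \<Sum>q\<in>Succ M s.
        kl_term (flow M x s q) (flow M \<pi> s q) (\<Sum>a\<in>avail M s. x s a))"

definition flow_balance ::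
  "('s, 'a) mdp \<Rightarrow> ('s \<Rightarrow> 'a \<Rightarrow> real) \<Rightarrow> 's set \<Rightarrow> ('s \<Rightarrow> 'a \<Rightarrow> real) \<Rightarrow> 's \<Rightarrow> real" where
  "flow_balance M \<pi> R x s =
     (\<Sum>a\<in>avail M s. x s a) - (\<Sum>q\<in>decision_states M \<pi> R. flow M x q s) - init_ind M s"

definition reach_prob ::
  "('s, 'a) mdp \<Rightarrow> ('s \<Rightarrow> 'a \<Rightarrow> real) \<Rightarrow> 's set \<Rightarrow> ('s \<Rightarrow> 'a \<Rightarrow> real) \<Rightarrow> real" where
  "reach_prob M \<pi> R x =
     (\<Sum>q\<in>R. init_ind M q + (\<Sum>s\<in>decision_states M \<pi> R. flow M x s q))"

text \<open>
  A joint vector is a function \<open>x\<close>, with \<open>x i s a\<close> the coordinate of agent \<open>i\<close> at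
  \<open>(s, a)\<close>. Only the values at the indices in \<open>coords\<close> are coordinates: the objective,
  the constraints and the distance do not depend on the others.
\<close>

definition coords ::
  "nat \<Rightarrow> (nat \<Rightarrow> ('s, 'a) mdp) \<Rightarrow> (nat \<Rightarrow> 's \<Rightarrow> 'a \<Rightarrow> real) \<Rightarrow> (nat \<Rightarrow> 's set) \<Rightarrow>
     (nat \<times> 's \<times> 'a) set" where
  "coords n M \<pi> R =
     (SIGMA i:{1..n}. SIGMA s:decision_states (M i) (\<pi> i) (R i). avail (M i) s)"

definition joint_dist ::
  "nat \<Rightarrow> (nat \<Rightarrow> ('s, 'a) mdp) \<Rightarrow> (nat \<Rightarrow> 's \<Rightarrow> 'a \<Rightarrow> real) \<Rightarrow> (nat \<Rightarrow> 's set) \<Rightarrow>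
     (nat \<Rightarrow> 's \<Rightarrow> 'a \<Rightarrow> real) \<Rightarrow> (nat \<Rightarrow> 's \<Rightarrow> 'a \<Rightarrow> real) \<Rightarrow> real" where
  "joint_dist n M \<pi> R x y = L2_set (\<lambda>(i, s, a). x i s a - y i s a) (coords n M \<pi> R)"

definition objective ::
  "nat \<Rightarrow> (nat \<Rightarrow> ('s, 'a) mdp) \<Rightarrow> (nat \<Rightarrow> 's \<Rightarrow> 'a \<Rightarrow> real) \<Rightarrow> (nat \<Rightarrow> 's set) \<Rightarrow>
     (nat \<Rightarrow> 's \<Rightarrow> 'a \<Rightarrow> real) \<Rightarrow> ereal" where
  "objective n M \<pi> R x = (MAX i\<in>{1..n}. KL (M i) (\<pi> i) (R i) (x i))"

text \<open>
  For \<open>\<nu> = 1\<close> the product constraint says that some agent has \<open>reach_prob = 1\<close>. With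
  two or more agents the feasible set is then a union of faces, and a minimum over one
  face can be a local minimum of the problem without being a global one.
\<close>

definition feasible ::
  "nat \<Rightarrow> (nat \<Rightarrow> ('s, 'a) mdp) \<Rightarrow> (nat \<Rightarrow> 's \<Rightarrow> 'a \<Rightarrow> real) \<Rightarrow> (nat \<Rightarrow> 's set) \<Rightarrow> real \<Rightarrow>
     (nat \<Rightarrow> 's \<Rightarrow> 'a \<Rightarrow> real) \<Rightarrow> bool" where
  "feasible n M \<pi> R \<nu> x \<longleftrightarrow>
     (\<forall>i\<in>{1..n}. \<forall>s\<in>decision_states (M i) (\<pi> i) (R i).
        flow_balance (M i) (\<pi> i) (R i) (x i) s = 0) \<and>
     (\<Prod>i\<in>{1..n}. 1 - reach_prob (M i) (\<pi> i) (R i) (x i)) \<le> 1 - \<nu> \<and>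
     (\<forall>(i, s, a)\<in>coords n M \<pi> R. 0 \<le> x i s a)"

definition local_minimum ::
  "nat \<Rightarrow> (nat \<Rightarrow> ('s, 'a) mdp) \<Rightarrow> (nat \<Rightarrow> 's \<Rightarrow> 'a \<Rightarrow> real) \<Rightarrow> (nat \<Rightarrow> 's set) \<Rightarrow> real \<Rightarrow>
     (nat \<Rightarrow> 's \<Rightarrow> 'a \<Rightarrow> real) \<Rightarrow> bool" where
  "local_minimum n M \<pi> R \<nu> x \<longleftrightarrow>
     feasible n M \<pi> R \<nu> x \<and> \<bar>objective n M \<pi> R x\<bar> \<noteq> \<infinity> \<and>
     (\<exists>\<epsilon>>0. \<forall>y. feasible n M \<pi> R \<nu> y \<longrightarrow> joint_dist n M \<pi> R x y < \<epsilon> \<longrightarrow>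
        objective n M \<pi> R x \<le> objective n M \<pi> R y)"

definition global_minimum ::
  "nat \<Rightarrow> (nat \<Rightarrow> ('s, 'a) mdp) \<Rightarrow> (nat \<Rightarrow> 's \<Rightarrow> 'a \<Rightarrow> real) \<Rightarrow> (nat \<Rightarrow> 's set) \<Rightarrow> real \<Rightarrow>
     (nat \<Rightarrow> 's \<Rightarrow> 'a \<Rightarrow> real) \<Rightarrow> bool" where
  "global_minimum n M \<pi> R \<nu> x \<longleftrightarrow>
     feasible n M \<pi> R \<nu> x \<and>
     (\<forall>y. feasible n M \<pi> R \<nu> y \<longrightarrow> objective n M \<pi> R x \<le> objective n M \<pi> R y)"

end

theory Submission
  imports Defs
begin

text \<open>
  The feasible set need not be convex: the superlevel sets of a product of nonnegative reals
  are convex, so the product constraint cuts out the complement of such a set.  What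
  survives is the following.  Let \<open>x\<close> be a local minimum and suppose that a feasible
  \<open>y\<close> has a smaller objective value.  Each divergence is convex, so moving agent \<open>i\<close>
  from \<open>x i\<close> to \<open>x i + t * w i * (y i - x i)\<close> brings its divergence strictly below
  the value of \<open>x\<close>, for any speed \<open>w i > 0\<close> and any small \<open>t > 0\<close>: the bound holds for
  each agent separately, whatever the ratios between the speeds are
  (\<open>KL_mix_less\<close>).  The flow constraints are affine in each agent's vector, so these
  moves respect them.  The objective is a maximum over the agents, so the new point
  contradicts local minimality as soon as it satisfies the product constraint.

  The freedom in the speeds takes care of that constraint (\<open>small_step_prod_le\<close>).
  Put \<open>u i = 1 - reach_prob\<close> at \<open>x\<close>, \<open>v i = 1 - reach_prob\<close> at \<open>y\<close> and \<open>c = 1 - \<nu>\<close>;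
  the factors are nonnegative because the reachability value of a flow is at most one
  (\<open>reach_prob_le_1\<close>).  If the product of the \<open>u i\<close> is below \<open>c\<close>, continuity suffices.
  If it equals \<open>c > 0\<close>, then \<open>1 + s \<le> exp s\<close> shows that the product stays at most
  \<open>c\<close> when the weighted sum of the relative changes \<open>(v i - u i) / u i\<close> is at most
  zero.  Since the \<open>v i\<close> have a product no larger than the \<open>u i\<close>, either they all agree
  or some \<open>v j\<close> is smaller than \<open>u j\<close>; giving agent \<open>j\<close> a high enough speed then makes
  the weighted sum nonpositive.

  This argument divides by \<open>u i\<close> and so needs \<open>c > 0\<close>.  For several agents that follows
  from feasibility, which makes \<open>c\<close> an upper bound of a nonnegative product, together
  with \<open>\<nu> \<noteq> 1\<close>.  For a single agent the constraint is affine, and speed 1 works for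
  every \<open>c\<close>.
\<close>

section \<open>Staying below a bound on a product\<close>

lemma positive_weights_sum_nonpos:
  fixes d :: "'i \<Rightarrow> real"
  assumes I: "finite I" and d: "(\<exists>j\<in>I. d j < 0) \<or> (\<forall>i\<in>I. d i = 0)"
  obtains w where "\<And>i. w i > 0" "(\<Sum>i\<in>I. w i * d i) \<le> 0"
proof (cases "\<exists>j\<in>I. d j < 0")
  case True
  then obtain j where j: "j \<in> I" "d j < 0" by blast
  define T where "T = (\<Sum>i\<in>I - {j}. \<bar>d i\<bar>)"
  have T: "T \<ge> 0" unfolding T_def by (simp add: sum_nonneg)
  \<comment> \<open>At this speed the decrease in coordinate \<open>j\<close> outweighs \<open>T\<close>, which bounds all increases.\<close>
  define w where "w i = (if i = j then 1 + T / (- d j) else 1)" for i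
  have pos: "w i > 0" for i
    using T j by (simp add: w_def add_pos_nonneg divide_nonneg_neg)
  have "(\<Sum>i\<in>I. w i * d i) = w j * d j + (\<Sum>i\<in>I - {j}. d i)"
    using I j by (simp add: sum.remove w_def)
  also have "\<dots> \<le> w j * d j + T"
    unfolding T_def by (intro add_left_mono sum_mono) simp
  also have "\<dots> = d j"
    using j by (simp add: w_def field_simps)
  also have "\<dots> \<le> 0" using j by simp
  finally show thesis using pos that by blast
next
  case False
  with d show thesis using that[of "\<lambda>_. 1"] by simp
qed

text \<open>
  The straight path from \<open>u\<close> to \<open>v\<close> may violate the bound right away, even though both
  ends satisfy it; a path with suitable positive speeds in the coordinates does not.
\<close>

lemma small_step_prod_le:
  fixes u v :: "'i \<Rightarrow> real"
  assumes I: "finite I"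
    and u: "\<And>i. i \<in> I \<Longrightarrow> u i \<ge> 0" and v: "\<And>i. i \<in> I \<Longrightarrow> v i \<ge> 0"
    and pu: "(\<Prod>i\<in>I. u i) \<le> c" and pv: "(\<Prod>i\<in>I. v i) \<le> c"
    and c: "card I = 1 \<or> c > 0"
  obtains w where "\<And>i. w i > 0"
    "\<forall>\<^sub>F t in at_right 0. (\<Prod>i\<in>I. u i + t * w i * (v i - u i)) \<le> c"
proof (cases "card I = 1")
  case True
  then obtain k where k: "I = {k}" by (auto simp: card_1_singleton_iff)
  have "\<forall>\<^sub>F t in at_right 0. 0 < t \<and> t < (1::real)"
    by (simp add: eventually_at_right_less eventually_at_right_field eventually_conj_iff)
       (metis zero_less_one)
  then have "\<forall>\<^sub>F t in at_right 0. (\<Prod>i\<in>I. u i + t * 1 * (v i - u i)) \<le> c"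
  proof eventually_elim
    case (elim t)
    have "(1 - t) * u k + t * v k \<le> c"
      using elim pu pv k by (intro convex_bound_le) auto
    then show ?case using k by (simp add: algebra_simps)
  qed
  then show thesis by (intro that[of "\<lambda>_. 1"]) auto
next
  case False
  with c have c: "c > 0" by simp
  show thesis
  proof (cases "(\<Prod>i\<in>I. u i) < c")
    case True
    have "((\<lambda>t. \<Prod>i\<in>I. u i + t * 1 * (v i - u i)) \<longlongrightarrow> (\<Prod>i\<in>I. u i + 0 * 1 * (v i - u i)))
            (at_right 0)"
      by (intro tendsto_intros)
    then have "\<forall>\<^sub>F t in at_right 0. (\<Prod>i\<in>I. u i + t * 1 * (v i - u i)) < c"
      using True by (intro order_tendstoD(2)) auto
    then have "\<forall>\<^sub>F t in at_right 0. (\<Prod>i\<in>I. u i + t * 1 * (v i - u i)) \<le> c"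
      by eventually_elim simp
    then show thesis by (intro that[of "\<lambda>_. 1"]) auto
  next
    case False
    with pu have pu: "(\<Prod>i\<in>I. u i) = c" by simp
    have upos: "u i > 0" if "i \<in> I" for i
      using pu c u[OF that] I that by (metis less_eq_real_def prod_zero_iff less_irrefl)
    define d where "d i = v i / u i - 1" for i
    have "(\<exists>j\<in>I. d j < 0) \<or> (\<forall>i\<in>I. d i = 0)"
    proof (rule ccontr)
      assume "\<not> ?thesis"
      then have nonneg: "\<And>i. i \<in> I \<Longrightarrow> d i \<ge> 0" and "\<exists>j\<in>I. d j \<noteq> 0" by force+
      then obtain j where j: "j \<in> I" "d j > 0" by force
      have "1 < 1 + d j" using j by simp
      also have "\<dots> \<le> (1 + d j) * (\<Prod>i\<in>I - {j}. 1 + d i)"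
      proof -
        have "1 \<le> (\<Prod>i\<in>I - {j}. 1 + d i)" using nonneg by (intro prod_ge_1) auto
        then show ?thesis using j by (simp add: mult_le_cancel_left1)
      qed
      also have "\<dots> = (\<Prod>i\<in>I. v i / u i)"
        using I j by (simp add: d_def prod.remove)
      also have "\<dots> = (\<Prod>i\<in>I. v i) / c" using pu by (simp add: prod_dividef)
      also have "\<dots> \<le> 1" using pv c by simp
      finally show False by simp
    qed
    then obtain w where w: "\<And>i. w i > 0" "(\<Sum>i\<in>I. w i * d i) \<le> 0"
      using positive_weights_sum_nonpos[OF I] by blast
    have "\<forall>\<^sub>F t in at_right 0. t * w i < 1" for i
    proof -
      have "((\<lambda>t. t * w i) \<longlongrightarrow> 0 * w i) (at_right 0)" by (intro tendsto_intros)
      then show ?thesis by (intro order_tendstoD(2)) auto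
    qed
    then have "\<forall>\<^sub>F t in at_right 0. \<forall>i\<in>I. t * w i < 1"
      using I by (simp add: eventually_ball_finite)
    moreover have "\<forall>\<^sub>F t in at_right 0. (0::real) < t" by (rule eventually_at_right_less)
    ultimately
    have "\<forall>\<^sub>F t in at_right 0. (\<Prod>i\<in>I. u i + t * w i * (v i - u i)) \<le> c"
    proof eventually_elim
      case (elim t)
      \<comment> \<open>A product of bounds on the factors needs the factors to be nonnegative.\<close>
      have "1 + t * w i * d i \<ge> 0" if "i \<in> I" for i
      proof -
        have "1 + t * w i * d i = (1 - t * w i) + t * w i * (v i / u i)"
          by (simp add: d_def algebra_simps)
        also have "\<dots> \<ge> 0"
          using elim that w(1)[of i] u v by (intro add_nonneg_nonneg mult_nonneg_nonneg) auto
        finally show ?thesis .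
      qed
      then have "(\<Prod>i\<in>I. 1 + t * w i * d i) \<le> (\<Prod>i\<in>I. exp (t * w i * d i))"
        by (intro prod_mono) (simp add: exp_ge_add_one_self)
      also have "\<dots> = exp (t * (\<Sum>i\<in>I. w i * d i))"
        using I by (simp add: exp_sum sum_distrib_left mult.assoc)
      also have "\<dots> \<le> 1" using elim w(2) by (simp add: mult_le_0_iff)
      finally have le1: "(\<Prod>i\<in>I. 1 + t * w i * d i) \<le> 1" .
      have "(\<Prod>i\<in>I. u i + t * w i * (v i - u i)) = (\<Prod>i\<in>I. u i * (1 + t * w i * d i))"
        by (intro prod.cong refl) (use upos in \<open>force simp: d_def field_simps\<close>)
      also have "\<dots> = c * (\<Prod>i\<in>I. 1 + t * w i * d i)" by (simp add: prod.distrib pu)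
      also have "\<dots> \<le> c" using le1 c by (simp add: mult_left_le)
      finally show ?case .
    qed
    then show thesis using w(1) that by blast
  qed
qed

section \<open>Flows and mixtures of occupation vectors\<close>

definition mix ::
  "real \<Rightarrow> ('s \<Rightarrow> 'a \<Rightarrow> real) \<Rightarrow> ('s \<Rightarrow> 'a \<Rightarrow> real) \<Rightarrow> 's \<Rightarrow> 'a \<Rightarrow> real" where
  "mix l x y s a = (1 - l) * x s a + l * y s a"

lemma mass_mix:
  "(\<Sum>a\<in>A. mix l x y s a) = (1 - l) * (\<Sum>a\<in>A. x s a) + l * (\<Sum>a\<in>A. y s a)"
  by (simp add: mix_def sum.distrib sum_distrib_left)

lemma flow_mix: "flow M (mix l x y) s q = (1 - l) * flow M x s q + l * flow M y s q"
  by (simp add: flow_def mix_def sum.distrib sum_distrib_left algebra_simps sum_subtractf)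

lemma flow_balance_mix:
  "flow_balance M \<pi> R (mix l x y) s
     = (1 - l) * flow_balance M \<pi> R x s + l * flow_balance M \<pi> R y s"
  unfolding flow_balance_def flow_mix mass_mix
  by (simp add: sum.distrib sum_subtractf sum_distrib_left algebra_simps)

lemma reach_prob_mix:
  "reach_prob M \<pi> R (mix l x y) = (1 - l) * reach_prob M \<pi> R x + l * reach_prob M \<pi> R y"
  unfolding reach_prob_def flow_mix
  by (simp add: sum.distrib sum_subtractf sum_distrib_left algebra_simps)

lemma decision_states_subset: "decision_states M \<pi> R \<subseteq> states M - R"
  by (auto simp: decision_states_def)

lemma flow_nonneg:
  assumes "finite_mdp M" "s \<in> states M" "q \<in> states M"
    and "\<And>a. a \<in> avail M s \<Longrightarrow> 0 \<le> x s a"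
  shows "0 \<le> flow M x s q"
  using assms by (auto simp: flow_def finite_mdp_def intro!: sum_nonneg)

lemma sum_flow:
  assumes "finite_mdp M" "s \<in> states M"
  shows "(\<Sum>q\<in>states M. flow M x s q) = (\<Sum>a\<in>avail M s. x s a)"
proof -
  have "(\<Sum>q\<in>states M. flow M x s q) = (\<Sum>a\<in>avail M s. x s a * (\<Sum>q\<in>states M. prob M s a q))"
    unfolding flow_def by (subst sum.swap) (simp add: sum_distrib_left)
  also have "\<dots> = (\<Sum>a\<in>avail M s. x s a)"
    using assms by (intro sum.cong) (auto simp: finite_mdp_def)
  finally show ?thesis .
qed

lemma flow_le_mass:
  assumes M: "finite_mdp M" and s: "s \<in> states M" and q: "q \<in> states M"
    and x: "\<And>a. a \<in> avail M s \<Longrightarrow> 0 \<le> x s a"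
  shows "flow M x s q \<le> (\<Sum>a\<in>avail M s. x s a)"
proof -
  have "flow M x s q \<le> (\<Sum>q\<in>states M. flow M x s q)"
    using M q flow_nonneg[of M s _ x, OF M s] x
    by (intro member_le_sum) (auto simp: finite_mdp_def)
  then show ?thesis by (simp add: sum_flow[OF M s])
qed

text \<open>
  Summed over the decision states, the balance equations say that the flow out of this
  set is the mass injected into it, so the flow from it into \<open>R\<close> is at most that mass.  As
  \<open>R\<close> contains no decision state, the unit of mass at the initial state is counted once,
  either directly in \<open>R\<close> or as injected mass.
\<close>

lemma reach_prob_le_1:
  assumes M: "finite_mdp M" and R: "R \<subseteq> states M"
    and x: "\<And>s a. s \<in> decision_states M \<pi> R \<Longrightarrow> a \<in> avail M s \<Longrightarrow> 0 \<le> x s a"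
    and bal: "\<And>s. s \<in> decision_states M \<pi> R \<Longrightarrow> flow_balance M \<pi> R x s = 0"
  shows "reach_prob M \<pi> R x \<le> 1"
proof -
  let ?D = "decision_states M \<pi> R"
  have D: "?D \<subseteq> states M" "?D \<inter> R = {}" using decision_states_subset[of M \<pi> R] by auto
  have fin: "finite (states M)" "finite ?D" "finite R"
    using M D R by (auto simp: finite_mdp_def intro: finite_subset)
  have "(\<Sum>s\<in>?D. \<Sum>q\<in>R. flow M x s q) + (\<Sum>s\<in>?D. \<Sum>q\<in>?D. flow M x s q)
          = (\<Sum>s\<in>?D. \<Sum>q\<in>R \<union> ?D. flow M x s q)"
    using fin D by (subst sum.union_disjoint) (auto simp: sum.distrib)
  also have "\<dots> \<le> (\<Sum>s\<in>?D. \<Sum>q\<in>states M. flow M x s q)"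
    using fin D R x by (intro sum_mono sum_mono2) (auto intro!: flow_nonneg[OF M])
  also have "\<dots> = (\<Sum>s\<in>?D. \<Sum>a\<in>avail M s. x s a)"
    using D by (intro sum.cong) (auto simp: sum_flow[OF M])
  also have "\<dots> = (\<Sum>s\<in>?D. init_ind M s + (\<Sum>q\<in>?D. flow M x q s))"
    using bal by (intro sum.cong) (force simp: flow_balance_def)+
  also have "\<dots> = (\<Sum>s\<in>?D. init_ind M s) + (\<Sum>s\<in>?D. \<Sum>q\<in>?D. flow M x s q)"
    by (simp add: sum.distrib sum.swap[of "\<lambda>s q. flow M x q s"])
  finally have "(\<Sum>s\<in>?D. \<Sum>q\<in>R. flow M x s q) \<le> (\<Sum>s\<in>?D. init_ind M s)" by simp
  then have "reach_prob M \<pi> R x \<le> (\<Sum>q\<in>R. init_ind M q) + (\<Sum>s\<in>?D. init_ind M s)"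
    by (simp add: reach_prob_def sum.distrib sum.swap[of _ R])
  also have "\<dots> = (\<Sum>q\<in>R \<union> ?D. init_ind M q)"
    using fin D by (subst sum.union_disjoint) auto
  also have "\<dots> \<le> 1" using fin by (simp add: init_ind_def)
  finally show ?thesis .
qed

section \<open>Convexity of the divergence\<close>

text \<open>
  The right-hand side is the tangent plane at \<open>(Y, Z)\<close> of the jointly convex function
  on the left, the perspective of \<open>y * ln y\<close> up to a linear term; it is the inequality \<open>ln r \<le> r - 1\<close> at
  \<open>r = (Y / Z) * (z / y)\<close>.  Only the point of tangency has to be interior, so the two
  ends of a segment may lie on the boundary \<open>y = 0\<close>.
\<close>

lemma perspective_ln_tangent:
  fixes y z p Y Z :: real
  assumes "0 \<le> y" "y \<le> z" "0 < p" "0 < Y" "0 < Z"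
  shows "y * ln (Y / (p * Z)) + y - z * (Y / Z) \<le> y * ln (y / (p * z))"
proof (cases "y = 0")
  case True
  with assms show ?thesis by simp
next
  case False
  with assms have pos: "0 < y" "0 < z" by auto
  let ?r = "(Y / Z) * (z / y)"
  have "0 < ?r" using assms pos by simp
  then have "ln ?r \<le> ?r - 1" by (rule ln_le_minus_one)
  moreover have "ln ?r = ln (Y / (p * Z)) - ln (y / (p * z))"
    using assms pos by (simp add: ln_div ln_mult)
  ultimately have "y * (ln (Y / (p * Z)) - ln (y / (p * z))) \<le> y * (?r - 1)"
    using pos by (simp add: mult_left_mono)
  also have "\<dots> = z * (Y / Z) - y" using pos by (simp add: field_simps)
  finally show ?thesis by (simp add: algebra_simps)
qed

lemma perspective_ln_convex:
  fixes y\<^sub>0 y\<^sub>1 z\<^sub>0 z\<^sub>1 p l :: real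
  assumes "0 \<le> y\<^sub>0" "y\<^sub>0 \<le> z\<^sub>0" "0 \<le> y\<^sub>1" "y\<^sub>1 \<le> z\<^sub>1" and p: "0 < p" and l: "0 < l" "l < 1"
  defines "Y \<equiv> (1 - l) * y\<^sub>0 + l * y\<^sub>1" and "Z \<equiv> (1 - l) * z\<^sub>0 + l * z\<^sub>1"
  shows "Y * ln (Y / (p * Z))
           \<le> (1 - l) * (y\<^sub>0 * ln (y\<^sub>0 / (p * z\<^sub>0))) + l * (y\<^sub>1 * ln (y\<^sub>1 / (p * z\<^sub>1)))"
proof (cases "Y = 0")
  case True
  have "0 \<le> (1 - l) * y\<^sub>0" "0 \<le> l * y\<^sub>1" using assms by auto
  with True have "(1 - l) * y\<^sub>0 = 0" "l * y\<^sub>1 = 0" unfolding Y_def by linarith+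
  with l have "y\<^sub>0 = 0" "y\<^sub>1 = 0" by auto
  then show ?thesis by (simp add: Y_def)
next
  case False
  have "0 \<le> Y" unfolding Y_def using assms(1,3) l by simp
  with False have Y: "0 < Y" by simp
  have "Y \<le> Z" unfolding Y_def Z_def using assms(2,4) l by (intro add_mono mult_left_mono) auto
  with Y have Z: "0 < Z" by simp
  define L where "L = ln (Y / (p * Z))"
  define K where "K = Y / Z"
  have "(1 - l) * (y\<^sub>0 * L + y\<^sub>0 - z\<^sub>0 * K) + l * (y\<^sub>1 * L + y\<^sub>1 - z\<^sub>1 * K)
          \<le> (1 - l) * (y\<^sub>0 * ln (y\<^sub>0 / (p * z\<^sub>0))) + l * (y\<^sub>1 * ln (y\<^sub>1 / (p * z\<^sub>1)))"
    unfolding L_def K_def using assms(1-4) p l Y Z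
    by (intro add_mono mult_left_mono perspective_ln_tangent) auto
  also have "(1 - l) * (y\<^sub>0 * L + y\<^sub>0 - z\<^sub>0 * K) + l * (y\<^sub>1 * L + y\<^sub>1 - z\<^sub>1 * K) = Y * L + Y - Z * K"
    unfolding Y_def Z_def by (simp add: algebra_simps)
  also have "\<dots> = Y * L" using Z by (simp add: K_def)
  finally show ?thesis by (simp add: L_def)
qed

text \<open>
  Convexity is proved for real sums.  A flow that vanishes on the transitions excluded by
  the reference policy meets no infinite term; the value that a real quotient by zero
  takes is then immaterial, because the factor in front of the logarithm is zero.
\<close>

lemma KL_eq_real:
  assumes "\<And>s q. s \<in> decision_states M \<pi> R \<Longrightarrow> q \<in> Succ M s \<Longrightarrow>
             0 \<le> flow M x s q \<and> (flow M \<pi> s q = 0 \<longrightarrow> flow M x s q = 0)"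
  shows "KL M \<pi> R x = ereal (\<Sum>s\<in>decision_states M \<pi> R. \<Sum>q\<in>Succ M s.
           flow M x s q * ln (flow M x s q / (flow M \<pi> s q * (\<Sum>a\<in>avail M s. x s a))))"
proof -
  have "KL M \<pi> R x = (\<Sum>s\<in>decision_states M \<pi> R. \<Sum>q\<in>Succ M s. ereal (
           flow M x s q * ln (flow M x s q / (flow M \<pi> s q * (\<Sum>a\<in>avail M s. x s a)))))"
    unfolding KL_def using assms by (intro sum.cong refl) (fastforce simp: kl_term_def)
  then show ?thesis by simp
qed

lemma finite_Succ: "finite_mdp M \<Longrightarrow> finite (Succ M s)"
  by (auto simp: finite_mdp_def Succ_def)

lemma flow_support_of_KL_finite:
  assumes M: "finite_mdp M" and fin: "KL M \<pi> R x \<noteq> \<infinity>"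
    and s: "s \<in> decision_states M \<pi> R" and q: "q \<in> Succ M s"
    and x: "0 \<le> flow M x s q" and p: "flow M \<pi> s q = 0"
  shows "flow M x s q = 0"
proof (rule ccontr)
  assume "flow M x s q \<noteq> 0"
  with x p have "kl_term (flow M x s q) (flow M \<pi> s q) (\<Sum>a\<in>avail M s. x s a) = \<infinity>"
    by (simp add: kl_term_def)
  moreover have "finite (decision_states M \<pi> R)"
    using M by (simp add: finite_mdp_def decision_states_def)
  ultimately have "KL M \<pi> R x = \<infinity>"
    unfolding KL_def using s q finite_Succ[OF M] by (auto simp: sum_Pinfty)
  with fin show False by simp
qed

text \<open>
  The strict bound at \<open>y\<close> carries over to the mixture because \<open>l > 0\<close>.  Any weight
  strictly between 0 and 1 will do, which lets every agent move at a speed of its own.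
\<close>

lemma KL_mix_less:
  fixes c :: real
  assumes M: "finite_mdp M" and \<pi>: "stationary_policy M \<pi>"
    and x: "\<And>s a. s \<in> decision_states M \<pi> R \<Longrightarrow> a \<in> avail M s \<Longrightarrow> 0 \<le> x s a"
    and y: "\<And>s a. s \<in> decision_states M \<pi> R \<Longrightarrow> a \<in> avail M s \<Longrightarrow> 0 \<le> y s a"
    and KLx: "KL M \<pi> R x \<le> ereal c" and KLy: "KL M \<pi> R y < ereal c"
    and l: "0 < l" "l < 1"
  shows "KL M \<pi> R (mix l x y) < ereal c"
proof -
  let ?D = "decision_states M \<pi> R"
  let ?f = "\<lambda>w s q. flow M w s q * ln (flow M w s q / (flow M \<pi> s q * (\<Sum>a\<in>avail M s. w s a)))"
  let ?K = "\<lambda>w. \<Sum>s\<in>?D. \<Sum>q\<in>Succ M s. ?f w s q"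
  have st: "s \<in> states M" if "s \<in> ?D" for s
    using that decision_states_subset[of M \<pi> R] by auto
  have sq: "q \<in> states M" if "q \<in> Succ M s" for s q using that by (simp add: Succ_def)
  have p: "0 \<le> flow M \<pi> s q" if "s \<in> ?D" "q \<in> Succ M s" for s q
    using M \<pi> st[OF that(1)] sq[OF that(2)]
    by (intro flow_nonneg) (auto 4 4 simp: stationary_policy_def finite_mdp_def subset_iff)
  have finite_KL: "KL M \<pi> R x \<noteq> \<infinity>" "KL M \<pi> R y \<noteq> \<infinity>" using KLx KLy by auto
  have fx: "0 \<le> flow M x s q" "flow M x s q \<le> (\<Sum>a\<in>avail M s. x s a)"
      "flow M \<pi> s q = 0 \<Longrightarrow> flow M x s q = 0"
    and fy: "0 \<le> flow M y s q" "flow M y s q \<le> (\<Sum>a\<in>avail M s. y s a)"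
      "flow M \<pi> s q = 0 \<Longrightarrow> flow M y s q = 0"
    if "s \<in> ?D" "q \<in> Succ M s" for s q
  proof -
    show x0: "0 \<le> flow M x s q" and y0: "0 \<le> flow M y s q"
      using flow_nonneg[OF M st[OF that(1)] sq[OF that(2)]] x y that by auto
    show "flow M x s q \<le> (\<Sum>a\<in>avail M s. x s a)" "flow M y s q \<le> (\<Sum>a\<in>avail M s. y s a)"
      using flow_le_mass[OF M st[OF that(1)] sq[OF that(2)]] x y that by auto
    show "flow M \<pi> s q = 0 \<Longrightarrow> flow M x s q = 0" "flow M \<pi> s q = 0 \<Longrightarrow> flow M y s q = 0"
      using flow_support_of_KL_finite[OF M _ that] finite_KL x0 y0 by auto
  qed
  have eqs: "KL M \<pi> R x = ereal (?K x)" "KL M \<pi> R y = ereal (?K y)"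
      "KL M \<pi> R (mix l x y) = ereal (?K (mix l x y))"
    by (rule KL_eq_real; use fx fy l in \<open>auto simp: flow_mix\<close>)+
  have "?f (mix l x y) s q \<le> (1 - l) * ?f x s q + l * ?f y s q" if "s \<in> ?D" "q \<in> Succ M s" for s q
  proof (cases "flow M \<pi> s q = 0")
    case True
    then show ?thesis using fx(3) fy(3) that by (simp add: flow_mix)
  next
    case False
    with p[OF that] have "0 < flow M \<pi> s q" by simp
    then show ?thesis
      unfolding flow_mix mass_mix using fx fy that l by (intro perspective_ln_convex) auto
  qed
  then have "?K (mix l x y) \<le> (\<Sum>s\<in>?D. \<Sum>q\<in>Succ M s. (1 - l) * ?f x s q + l * ?f y s q)"
    by (intro sum_mono)
  also have "\<dots> = (1 - l) * ?K x + l * ?K y"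
    by (simp add: sum.distrib sum_distrib_left)
  also have "\<dots> < (1 - l) * c + l * c"
    using KLx KLy l unfolding eqs by (intro add_le_less_mono mult_left_mono mult_strict_left_mono) auto
  also have "\<dots> = c" by (simp add: algebra_simps)
  finally show ?thesis by (simp add: eqs)
qed

section \<open>Local minima are global\<close>

theorem theorem1:
  fixes n :: nat
    and M :: "nat \<Rightarrow> ('s, 'a) mdp"
    and \<pi> :: "nat \<Rightarrow> 's \<Rightarrow> 'a \<Rightarrow> real"
    and R :: "nat \<Rightarrow> 's set"
    and \<nu> :: real
    and x :: "nat \<Rightarrow> 's \<Rightarrow> 'a \<Rightarrow> real"
  assumes "n \<ge> 1"
    and "\<And>i. i \<in> {1..n} \<Longrightarrow> finite_mdp (M i)"
    and "\<And>i. i \<in> {1..n} \<Longrightarrow> stationary_policy (M i) (\<pi> i)"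
    and "\<And>i. i \<in> {1..n} \<Longrightarrow> R i \<subseteq> {s. absorbing (M i) s}"
    and "\<nu> \<ge> 0"
    and "n = 1 \<or> \<nu> \<noteq> 1"
    and "local_minimum n M \<pi> R \<nu> x"
  shows "global_minimum n M \<pi> R \<nu> x"
proof (rule ccontr)
  note M = assms(2) and \<pi> = assms(3)
  let ?D = "\<lambda>i. decision_states (M i) (\<pi> i) (R i)"
  let ?\<nu> = "\<lambda>z i. reach_prob (M i) (\<pi> i) (R i) (z i)"
  let ?KL = "\<lambda>z i. KL (M i) (\<pi> i) (R i) (z i)"
  have balD: "flow_balance (M i) (\<pi> i) (R i) (z i) s = 0"
    and nonnegD: "a \<in> avail (M i) s \<Longrightarrow> 0 \<le> z i s a"
    if "feasible n M \<pi> R \<nu> z" "i \<in> {1..n}" "s \<in> ?D i" for z i s a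
    using that by (auto simp: feasible_def coords_def)
  have reach: "?\<nu> z i \<le> 1" if "feasible n M \<pi> R \<nu> z" "i \<in> {1..n}" for z i
    using assms(4)[OF that(2)] balD[OF that] nonnegD[OF that]
    by (intro reach_prob_le_1[OF M[OF that(2)]]) (auto simp: absorbing_def)
  have prodD: "(\<Prod>i\<in>{1..n}. 1 - ?\<nu> z i) \<le> 1 - \<nu>" if "feasible n M \<pi> R \<nu> z" for z
    using that by (simp add: feasible_def)

  from assms(7) obtain \<epsilon> where x: "feasible n M \<pi> R \<nu> x"
    and fin: "\<bar>objective n M \<pi> R x\<bar> \<noteq> \<infinity>" and \<epsilon>: "\<epsilon> > 0"
    and locmin: "\<And>z. feasible n M \<pi> R \<nu> z \<Longrightarrow> joint_dist n M \<pi> R x z < \<epsilon> \<Longrightarrow>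
        objective n M \<pi> R x \<le> objective n M \<pi> R z"
    by (auto simp: local_minimum_def)
  from fin obtain c where c: "objective n M \<pi> R x = ereal c" by auto
  assume "\<not> global_minimum n M \<pi> R \<nu> x"
  with x obtain y where y: "feasible n M \<pi> R \<nu> y" and "objective n M \<pi> R y < ereal c"
    by (auto simp: global_minimum_def c not_le)
  then have KLy: "?KL y i < ereal c" if "i \<in> {1..n}" for i
    using that by (auto simp: objective_def)
  have KLx: "?KL x i \<le> ereal c" if "i \<in> {1..n}" for i
    unfolding c[symmetric] objective_def using that by (intro Max_ge) auto

  have "card {1..n} = 1 \<or> 1 - \<nu> > 0"
  proof (cases "n = 1")
    case False
    have "0 \<le> (\<Prod>i\<in>{1..n}. 1 - ?\<nu> x i)" using reach[OF x] by (intro prod_nonneg) auto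
    then show ?thesis using prodD[OF x] assms(6) False by auto
  qed simp
  then obtain w where w: "\<And>i. w i > 0"
    and small: "\<forall>\<^sub>F t in at_right 0.
      (\<Prod>i\<in>{1..n}. (1 - ?\<nu> x i) + t * w i * ((1 - ?\<nu> y i) - (1 - ?\<nu> x i))) \<le> 1 - \<nu>"
    using small_step_prod_le[of "{1..n}" "\<lambda>i. 1 - ?\<nu> x i" "\<lambda>i. 1 - ?\<nu> y i" "1 - \<nu>"]
      prodD[OF x] prodD[OF y] reach[OF x] reach[OF y] by auto
  define z where "z t i = mix (t * w i) (x i) (y i)" for t i
  define B where "B = L2_set (\<lambda>(i, s, a). w i * (x i s a - y i s a)) (coords n M \<pi> R)"
  have dist: "joint_dist n M \<pi> R x (z t) = t * B" if "0 \<le> t" for t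
  proof -
    have "t * B = L2_set (\<lambda>k. t * (\<lambda>(i, s, a). w i * (x i s a - y i s a)) k) (coords n M \<pi> R)"
      unfolding B_def using that by (rule L2_set_right_distrib)
    also have "\<dots> = joint_dist n M \<pi> R x (z t)"
      unfolding joint_dist_def
      by (intro L2_set_cong) (auto simp: z_def mix_def algebra_simps)
    finally show ?thesis by simp
  qed
  have lim: "\<forall>\<^sub>F t in at_right 0. t * b < e" if "0 < e" for b e :: real
  proof -
    have "((\<lambda>t. t * b) \<longlongrightarrow> 0 * b) (at_right 0)" by (intro tendsto_intros)
    then show ?thesis using that by (intro order_tendstoD(2)) auto
  qed
  have "\<forall>\<^sub>F t in at_right 0. \<forall>i\<in>{1..n}. t * w i < 1"
    by (intro eventually_ball_finite) (auto intro: lim)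
  then have "\<forall>\<^sub>F t in at_right 0. 0 < t \<and> (\<forall>i\<in>{1..n}. t * w i < 1) \<and> t * B < \<epsilon> \<and>
      (\<Prod>i\<in>{1..n}. (1 - ?\<nu> x i) + t * w i * ((1 - ?\<nu> y i) - (1 - ?\<nu> x i))) \<le> 1 - \<nu>"
    using small lim[OF \<epsilon>, of B] eventually_at_right_less[of "0::real"]
    by eventually_elim simp
  from eventually_happens'[OF _ this] obtain t
    where t: "0 < t" "\<And>i. i \<in> {1..n} \<Longrightarrow> t * w i < 1" "t * B < \<epsilon>"
      and prod: "(\<Prod>i\<in>{1..n}. (1 - ?\<nu> x i) + t * w i * ((1 - ?\<nu> y i) - (1 - ?\<nu> x i))) \<le> 1 - \<nu>"
    by auto
  have tw: "0 < t * w i" for i using t(1) w by simp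

  have "feasible n M \<pi> R \<nu> (z t)"
    unfolding feasible_def
  proof (intro conjI ballI)
    fix i s assume "i \<in> {1..n}" "s \<in> ?D i"
    then show "flow_balance (M i) (\<pi> i) (R i) (z t i) s = 0"
      using balD x y by (simp add: z_def flow_balance_mix)
  next
    have "(\<Prod>i\<in>{1..n}. 1 - ?\<nu> (z t) i)
        = (\<Prod>i\<in>{1..n}. (1 - ?\<nu> x i) + t * w i * ((1 - ?\<nu> y i) - (1 - ?\<nu> x i)))"
      by (intro prod.cong) (auto simp: z_def reach_prob_mix algebra_simps)
    with prod show "(\<Prod>i\<in>{1..n}. 1 - ?\<nu> (z t) i) \<le> 1 - \<nu>" by simp
  next
    fix k assume "k \<in> coords n M \<pi> R"
    then obtain i s a where k: "k = (i, s, a)" "i \<in> {1..n}" "s \<in> ?D i" "a \<in> avail (M i) s"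
      by (auto simp: coords_def)
    have "0 \<le> (1 - t * w i) * x i s a + t * w i * y i s a"
      using less_imp_le[OF tw[of i]] t(2)[OF k(2)] nonnegD[OF x k(2-4)] nonnegD[OF y k(2-4)]
      by (intro add_nonneg_nonneg mult_nonneg_nonneg[of "1 - t * w i"]
          mult_nonneg_nonneg[of "t * w i"]) auto
    then show "case k of (i, s, a) \<Rightarrow> 0 \<le> z t i s a" by (simp add: k z_def mix_def)
  qed
  moreover have "joint_dist n M \<pi> R x (z t) < \<epsilon>" using t dist by simp
  ultimately have "ereal c \<le> objective n M \<pi> R (z t)" using locmin c by simp
  moreover have "?KL (z t) i < ereal c" if "i \<in> {1..n}" for i
    unfolding z_def
    using nonnegD[OF x that] nonnegD[OF y that] KLx[OF that] KLy[OF that] tw t(2)[OF that]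
    by (intro KL_mix_less M \<pi> that) auto
  then have "objective n M \<pi> R (z t) < ereal c"
    using assms(1) by (simp add: objective_def)
  ultimately show False by simp
qed

end
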